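(* There is an everywhere defined unbounded linear operator on some Hilbert space which is injective but not surjective, and there is an everywhere defined unbounded linear operator on some Hilbert space which is surjective but not injective.
   Context: Hilbert spaces are complex. A linear operator $T$ on a Hilbert space $K$ is everywhere defined if its domain is $D(T)=K$; injectivity and surjectivity refer to $T$ as a linear map $K\to K$. *)

theory Defs
  imports "HOL-Analysis.Abstract_Metric_Spaces" "HOL-Algebra.Module"
begin

definition complex_field :: "complex ring" where
  "complex_field = \<lparr>carrier = UNIV, monoid.mult = (*), one = 1, zero = 0, add = (+)\<rparr>"

text \<open>
  The vector space part of an inner product space is an HOL-Algebra module over the complex
  field. The components \<open>mult\<close> and \<open>one\<close>, which every HOL-Algebra module record inherits from
  the ring record, play no role.
\<close>
record 'v inner_space = "(complex, 'v) module" +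
  cinner :: "'v \<Rightarrow> 'v \<Rightarrow> complex"

definition cnorm :: "('v, 'm) inner_space_scheme \<Rightarrow> 'v \<Rightarrow> real" where
  "cnorm K x = sqrt (Re (cinner K x x))"

text \<open>The inner product is linear in the first argument.\<close>
locale complex_inner_product_space = Module.module complex_field K
  for K :: "('v, 'm) inner_space_scheme" (structure) +
  assumes cinner_add_left:
      "\<lbrakk>x \<in> carrier K; y \<in> carrier K; z \<in> carrier K\<rbrakk>
        \<Longrightarrow> cinner K (x \<oplus>\<^bsub>K\<^esub> y) z = cinner K x z + cinner K y z"
    and cinner_smult_left:
      "\<lbrakk>x \<in> carrier K; y \<in> carrier K\<rbrakk> \<Longrightarrow> cinner K (a \<odot>\<^bsub>K\<^esub> x) y = a * cinner K x y"
    and cinner_commute: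
      "\<lbrakk>x \<in> carrier K; y \<in> carrier K\<rbrakk> \<Longrightarrow> cinner K x y = cnj (cinner K y x)"
    and cinner_self_nonneg: "x \<in> carrier K \<Longrightarrow> Re (cinner K x x) \<ge> 0"
    and cinner_self_eq_zeroD: "\<lbrakk>x \<in> carrier K; cinner K x x = 0\<rbrakk> \<Longrightarrow> x = \<zero>\<^bsub>K\<^esub>"

locale complex_hilbert_space = complex_inner_product_space K
  for K :: "('v, 'm) inner_space_scheme" (structure) +
  assumes complete: "Metric_space.mcomplete (carrier K) (\<lambda>x y. cnorm K (x \<ominus>\<^bsub>K\<^esub> y))"

text \<open>
  A linear operator on \<open>K\<close> is given by its domain \<open>D\<close>, a linear subspace of \<open>K\<close>, together with
  a linear map \<open>T\<close> from \<open>D\<close> to \<open>K\<close>; the values of \<open>T\<close> outside \<open>D\<close> are irrelevant.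
\<close>
definition linear_operator ::
  "('v, 'm) inner_space_scheme \<Rightarrow> 'v set \<Rightarrow> ('v \<Rightarrow> 'v) \<Rightarrow> bool" where
  "linear_operator K D T \<longleftrightarrow>
     submodule D complex_field K \<and>
     T \<in> D \<rightarrow> carrier K \<and>
     (\<forall>x\<in>D. \<forall>y\<in>D. T (x \<oplus>\<^bsub>K\<^esub> y) = T x \<oplus>\<^bsub>K\<^esub> T y) \<and>
     (\<forall>a. \<forall>x\<in>D. T (a \<odot>\<^bsub>K\<^esub> x) = a \<odot>\<^bsub>K\<^esub> T x)"

definition everywhere_defined :: "('v, 'm) inner_space_scheme \<Rightarrow> 'v set \<Rightarrow> bool" where
  "everywhere_defined K D \<longleftrightarrow> D = carrier K"

definition bounded_operator ::
  "('v, 'm) inner_space_scheme \<Rightarrow> 'v set \<Rightarrow> ('v \<Rightarrow> 'v) \<Rightarrow> bool" where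
  "bounded_operator K D T \<longleftrightarrow> (\<exists>C. \<forall>x\<in>D. cnorm K (T x) \<le> C * cnorm K x)"

end

theory Submission
  imports Defs "HOL-Analysis.L2_Norm" "HOL-Library.Function_Algebras"
begin

text \<open>
  Both operators live on the Hilbert space of square summable sequences. Its dense subspace of
  finitely supported sequences carries explicit unbounded linear maps: the weighted forward shift
  \<open>e\<^sub>n \<mapsto> (n + 1) e\<^sub>n\<^sub>+\<^sub>1\<close>, which is injective but misses \<open>e\<^sub>0\<close>, and the weighted backward shift
  \<open>e\<^sub>0 \<mapsto> 0\<close>, \<open>e\<^sub>n\<^sub>+\<^sub>1 \<mapsto> (n + 1) e\<^sub>n\<close>, which is surjective but kills \<open>e\<^sub>0\<close>.

  The axiom of choice provides an algebraic (discontinuous) linear projection \<open>P\<close> onto the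
  finitely supported sequences, hence an algebraic complement of them, namely the kernel of \<open>P\<close>.
  Letting a linear self-map \<open>S\<close> of the finitely supported sequences act on its own summand and
  the identity act on the complement gives the everywhere defined operator
  \<open>T x = x - P x + S (P x)\<close>. Being a direct sum of \<open>S\<close> and an identity, \<open>T\<close> is injective, or
  surjective, exactly when \<open>S\<close> is; and it is unbounded because it extends \<open>S\<close>. This is lemma
  \<open>finite_sequence_map_extends\<close>, which reduces the theorem to the two shifts.
\<close>

section \<open>Square summable sequences\<close>

definition square_summable :: "(nat \<Rightarrow> complex) set" where
  "square_summable = {x. summable (\<lambda>n. (cmod (x n))\<^sup>2)}"

definition l2_norm :: "(nat \<Rightarrow> complex) \<Rightarrow> real" where
  "l2_norm x = sqrt (\<Sum>n. (cmod (x n))\<^sup>2)"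

text \<open>
  This lemma and the next characterise \<open>l2_norm\<close> as the supremum of the Euclidean norms of the
  initial segments. Membership, the triangle inequality and completeness are all transferred from
  finite sums through them.
\<close>
lemma L2_set_le_l2_norm:
  assumes "x \<in> square_summable"
  shows "L2_set (\<lambda>n. cmod (x n)) {..<N} \<le> l2_norm x"
  using assms unfolding L2_set_def l2_norm_def square_summable_def
  by (auto intro!: sum_le_suminf)

lemma l2_norm_leI:
  assumes le: "\<And>N. L2_set (\<lambda>n. cmod (x n)) {..<N} \<le> C"
  shows "x \<in> square_summable" and "l2_norm x \<le> C"
proof -
  have "0 \<le> C"
    using le[of 0] by simp
  have *: "(\<Sum>n<N. (cmod (x n))\<^sup>2) \<le> C\<^sup>2" for N
    using le[of N] unfolding L2_set_def by (simp add: sqrt_le_D)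
  have "summable (\<lambda>n. (cmod (x n))\<^sup>2)"
    by (rule summableI_nonneg_bounded[OF _ *]) simp
  then show "x \<in> square_summable"
    by (simp add: square_summable_def)
  from suminf_le_const[OF \<open>summable _\<close> *] \<open>0 \<le> C\<close> show "l2_norm x \<le> C"
    unfolding l2_norm_def by (simp add: real_le_lsqrt suminf_nonneg[OF \<open>summable _\<close>])
qed

lemma l2_norm_nonneg: "x \<in> square_summable \<Longrightarrow> 0 \<le> l2_norm x"
  using L2_set_le_l2_norm[of x 0] by simp

lemma cmod_le_l2_norm:
  assumes "x \<in> square_summable"
  shows "cmod (x n) \<le> l2_norm x"
proof -
  have "cmod (x n) \<le> L2_set (\<lambda>n. cmod (x n)) {..<Suc n}"
    by (rule member_le_L2_set[where f = "\<lambda>n. cmod (x n)"]) auto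
  also have "\<dots> \<le> l2_norm x"
    using assms by (rule L2_set_le_l2_norm)
  finally show ?thesis .
qed

lemma zero_square_summable: "0 \<in> square_summable"
  by (simp add: square_summable_def)

lemma
  assumes x: "x \<in> square_summable" and y: "y \<in> square_summable"
  shows add_square_summable: "x + y \<in> square_summable"
    and l2_norm_triangle: "l2_norm (x + y) \<le> l2_norm x + l2_norm y"
proof -
  have "L2_set (\<lambda>n. cmod ((x + y) n)) {..<N} \<le> l2_norm x + l2_norm y" for N
  proof -
    have "L2_set (\<lambda>n. cmod ((x + y) n)) {..<N}
        \<le> L2_set (\<lambda>n. cmod (x n) + cmod (y n)) {..<N}"
      by (rule L2_set_mono) (auto intro: norm_triangle_ineq)
    also have "\<dots> \<le> L2_set (\<lambda>n. cmod (x n)) {..<N} + L2_set (\<lambda>n. cmod (y n)) {..<N}"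
      by (rule L2_set_triangle_ineq)
    also have "\<dots> \<le> l2_norm x + l2_norm y"
      using x y by (intro add_mono L2_set_le_l2_norm)
    finally show ?thesis .
  qed
  from l2_norm_leI[OF this]
  show "x + y \<in> square_summable" "l2_norm (x + y) \<le> l2_norm x + l2_norm y"
    by blast+
qed

lemma scale_square_summable:
  "x \<in> square_summable \<Longrightarrow> (\<lambda>n. a * x n) \<in> square_summable"
  by (simp add: square_summable_def norm_mult power_mult_distrib summable_mult)

lemma uminus_square_summable: "x \<in> square_summable \<Longrightarrow> - x \<in> square_summable"
  by (simp add: square_summable_def)

lemma diff_square_summable:
  "x \<in> square_summable \<Longrightarrow> y \<in> square_summable \<Longrightarrow> x - y \<in> square_summable"
  using add_square_summable[of x "- y"] uminus_square_summable[of y] by simp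

lemma l2_norm_minus_commute: "l2_norm (x - y) = l2_norm (y - x)"
  by (simp add: l2_norm_def norm_minus_commute)

lemma l2_norm_eq_0_iff: "x \<in> square_summable \<Longrightarrow> l2_norm x = 0 \<longleftrightarrow> x = 0"
  by (simp add: l2_norm_def square_summable_def suminf_eq_zero_iff fun_eq_iff)

lemma summable_mult_cnj:
  assumes "x \<in> square_summable" "y \<in> square_summable"
  shows "summable (\<lambda>n. x n * cnj (y n))"
proof (rule summable_comparison_test)
  show "summable (\<lambda>n. (cmod (x n))\<^sup>2 + (cmod (y n))\<^sup>2)"
    using assms by (intro summable_add) (simp_all add: square_summable_def)
  have "norm (x n * cnj (y n)) \<le> (cmod (x n))\<^sup>2 + (cmod (y n))\<^sup>2" for n
  proof -
    have "0 \<le> (cmod (x n) - cmod (y n))\<^sup>2 + ((cmod (x n))\<^sup>2 + (cmod (y n))\<^sup>2)"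
      by simp
    then show ?thesis
      by (simp add: norm_mult power2_diff)
  qed
  then show "\<exists>N. \<forall>n\<ge>N. norm (x n * cnj (y n)) \<le> (cmod (x n))\<^sup>2 + (cmod (y n))\<^sup>2"
    by blast
qed

text \<open>
  The limit is taken coordinatewise. A bound for the distance of late members of the sequence
  bounds the Euclidean norm of every initial segment of their difference, and such a bound
  survives the passage to the limit in one of the two members.
\<close>
lemma square_summable_Cauchy_limit:
  fixes X :: "nat \<Rightarrow> nat \<Rightarrow> complex"
  assumes X: "\<And>n. X n \<in> square_summable"
    and Cauchy: "\<And>e. 0 < e \<Longrightarrow> \<exists>N. \<forall>m\<ge>N. \<forall>k\<ge>N. l2_norm (X m - X k) < e"
  obtains L where "L \<in> square_summable"
    and "\<And>e. 0 < e \<Longrightarrow> \<exists>N. \<forall>m\<ge>N. l2_norm (X m - L) < e"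
proof -
  have "Cauchy (\<lambda>k. X k n)" for n
  proof (rule metric_CauchyI)
    fix e :: real assume "0 < e"
    with Cauchy obtain N where N: "\<forall>m\<ge>N. \<forall>k\<ge>N. l2_norm (X m - X k) < e"
      by blast
    have "dist (X m n) (X k n) < e" if "N \<le> m" "N \<le> k" for m k
    proof -
      have "cmod ((X m - X k) n) \<le> l2_norm (X m - X k)"
        by (intro cmod_le_l2_norm diff_square_summable X)
      also have "\<dots> < e"
        using N that by blast
      finally show ?thesis
        by (simp add: dist_norm)
    qed
    then show "\<exists>N. \<forall>m\<ge>N. \<forall>k\<ge>N. dist (X m n) (X k n) < e"
      by blast
  qed
  then have "\<forall>n. \<exists>l. (\<lambda>k. X k n) \<longlonglongrightarrow> l"
    using Cauchy_convergent convergent_def by blast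
  then obtain L where L: "\<And>n. (\<lambda>k. X k n) \<longlonglongrightarrow> L n"
    by metis
  have approx: "\<exists>N. \<forall>m\<ge>N. X m - L \<in> square_summable \<and> l2_norm (X m - L) \<le> e" if "0 < e" for e
  proof -
    from Cauchy[OF that] obtain N where N: "\<forall>m\<ge>N. \<forall>k\<ge>N. l2_norm (X m - X k) < e"
      by blast
    have "L2_set (\<lambda>n. cmod ((X m - L) n)) {..<M} \<le> e" if "N \<le> m" for m M
    proof (rule LIMSEQ_le_const2)
      show "(\<lambda>k. L2_set (\<lambda>n. cmod ((X m - X k) n)) {..<M})
          \<longlonglongrightarrow> L2_set (\<lambda>n. cmod ((X m - L) n)) {..<M}"
        unfolding L2_set_def by (auto intro!: tendsto_intros L)
      show "\<exists>K. \<forall>k\<ge>K. L2_set (\<lambda>n. cmod ((X m - X k) n)) {..<M} \<le> e"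
        using N that L2_set_le_l2_norm[OF diff_square_summable[OF X X]]
        by (meson less_imp_le order_trans)
    qed
    then show ?thesis
      using l2_norm_leI by blast
  qed
  show thesis
  proof
    from approx[of 1] obtain m where "X m - L \<in> square_summable"
      by auto
    from diff_square_summable[OF X[of m] this] show "L \<in> square_summable"
      by simp
    show "\<exists>N. \<forall>m\<ge>N. l2_norm (X m - L) < e" if "0 < e" for e
      using approx[of "e / 2"] that by fastforce
  qed
qed


section \<open>The Hilbert space of square summable sequences\<close>

definition l2_part :: "(nat \<Rightarrow> complex) \<Rightarrow> nat \<Rightarrow> complex" where
  "l2_part x = (if x \<in> square_summable then x else 0)"

text \<open>
  Addition first replaces sequences that are not square summable by zero. On the carrier this
  changes nothing; outside of it, it makes the distance \<open>\<parallel>x - y\<parallel>\<close> nonnegative and symmetric for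
  all sequences, as a metric in the sense of \<^locale>\<open>Metric_space\<close> has to be on the whole type.
\<close>
definition l2_space :: "(nat \<Rightarrow> complex) inner_space" where
  "l2_space = \<lparr>carrier = square_summable, monoid.mult = (\<lambda>x y. 0), one = 0, zero = 0,
     add = (\<lambda>x y. l2_part x + l2_part y), smult = (\<lambda>a x n. a * x n),
     cinner = (\<lambda>x y. \<Sum>n. x n * cnj (y n))\<rparr>"

lemma l2_part_square_summable: "l2_part x \<in> square_summable"
  by (simp add: l2_part_def zero_square_summable)

lemma l2_space_simps [simp]:
  "carrier l2_space = square_summable"
  "zero l2_space = 0"
  "x \<in> square_summable \<Longrightarrow> y \<in> square_summable \<Longrightarrow> x \<oplus>\<^bsub>l2_space\<^esub> y = x + y"
  "a \<odot>\<^bsub>l2_space\<^esub> x = (\<lambda>n. a * x n)"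
  "cinner l2_space x y = (\<Sum>n. x n * cnj (y n))"
  by (simp_all add: l2_space_def l2_part_def)

text \<open>
  For \<open>x\<close> outside the carrier, \<open>x \<oplus> y\<close> is the truncation of \<open>y\<close>, so that zero is the only
  inverse of \<open>x\<close> in the carrier.
\<close>
lemma a_inv_l2_space: "\<ominus>\<^bsub>l2_space\<^esub> x = - l2_part x"
proof -
  have "(THE y. y \<in> square_summable \<and> l2_part x + l2_part y = 0 \<and> l2_part y + l2_part x = 0)
      = - l2_part x"
  proof (rule the_equality)
    show "- l2_part x \<in> square_summable \<and> l2_part x + l2_part (- l2_part x) = 0 \<and>
        l2_part (- l2_part x) + l2_part x = 0"
      using uminus_square_summable[OF l2_part_square_summable, of x]
      by (simp add: l2_part_def[of "- l2_part x"])
  next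
    fix y
    assume "y \<in> square_summable \<and> l2_part x + l2_part y = 0 \<and> l2_part y + l2_part x = 0"
    then show "y = - l2_part x"
      by (auto simp: l2_part_def[of y] eq_neg_iff_add_eq_0)
  qed
  then show ?thesis
    by (simp add: a_inv_def m_inv_def l2_space_def)
qed

lemma minus_l2_space: "x \<ominus>\<^bsub>l2_space\<^esub> y = l2_part x - l2_part y"
proof -
  have "l2_part (- l2_part y) = - l2_part y"
    using uminus_square_summable[OF l2_part_square_summable]
    by (simp add: l2_part_def[of "- l2_part y"])
  then show ?thesis
    unfolding a_minus_def a_inv_l2_space by (simp add: l2_space_def)
qed

lemma cinner_l2_space_self:
  assumes "x \<in> square_summable"
  shows "cinner l2_space x x = of_real ((l2_norm x)\<^sup>2)"
proof -
  have "summable (\<lambda>n. (cmod (x n))\<^sup>2)"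
    using assms by (simp add: square_summable_def)
  then show ?thesis
    by (simp add: l2_norm_def suminf_nonneg suminf_of_real complex_norm_square del: of_real_power)
qed

lemma cnorm_l2_space: "x \<in> square_summable \<Longrightarrow> cnorm l2_space x = l2_norm x"
  using l2_norm_nonneg[of x] unfolding cnorm_def cinner_l2_space_self by simp

lemma complex_field_cring: "cring complex_field"
  by (rule cringI, rule abelian_groupI)
    (auto simp: complex_field_def algebra_simps intro!: comm_monoidI exI[of _ "- x" for x])

lemma l2_space_module: "Module.module complex_field l2_space"
proof (rule Module.moduleI)
  show "cring complex_field"
    by (rule complex_field_cring)
  show "abelian_group l2_space"
  proof (rule abelian_groupI)
    show "\<exists>y\<in>carrier l2_space. y \<oplus>\<^bsub>l2_space\<^esub> x = \<zero>\<^bsub>l2_space\<^esub>" if "x \<in> carrier l2_space" for x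
      using that uminus_square_summable[of x] by (intro bexI[of _ "- x"]) auto
  qed (auto simp: add_square_summable zero_square_summable add.assoc add.commute)
qed (auto simp: complex_field_def scale_square_summable add_square_summable
      fun_eq_iff algebra_simps)

lemma l2_space_metric:
  "Metric_space square_summable (\<lambda>x y. cnorm l2_space (x \<ominus>\<^bsub>l2_space\<^esub> y))"
proof -
  have d: "cnorm l2_space (x \<ominus>\<^bsub>l2_space\<^esub> y) = l2_norm (l2_part x - l2_part y)" for x y
    by (simp add: minus_l2_space cnorm_l2_space diff_square_summable l2_part_square_summable)
  show ?thesis
    unfolding d
  proof
    fix x y z :: "nat \<Rightarrow> complex"
    show "0 \<le> l2_norm (l2_part x - l2_part y)"
      by (intro l2_norm_nonneg diff_square_summable l2_part_square_summable)
    show "l2_norm (l2_part x - l2_part y) = l2_norm (l2_part y - l2_part x)"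
      by (rule l2_norm_minus_commute)
    show "l2_norm (l2_part x - l2_part y) = 0 \<longleftrightarrow> x = y"
      if "x \<in> square_summable" "y \<in> square_summable"
      using that by (simp add: l2_norm_eq_0_iff diff_square_summable l2_part_def)
    show "l2_norm (l2_part x - l2_part z)
        \<le> l2_norm (l2_part x - l2_part y) + l2_norm (l2_part y - l2_part z)"
      using l2_norm_triangle[of "l2_part x - l2_part y" "l2_part y - l2_part z"]
      by (simp add: diff_square_summable l2_part_square_summable)
  qed
qed

lemma l2_space_complete:
  "Metric_space.mcomplete square_summable (\<lambda>x y. cnorm l2_space (x \<ominus>\<^bsub>l2_space\<^esub> y))"
proof -
  interpret Metric_space square_summable "\<lambda>x y. cnorm l2_space (x \<ominus>\<^bsub>l2_space\<^esub> y)"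
    by (rule l2_space_metric)
  have d: "cnorm l2_space (x \<ominus>\<^bsub>l2_space\<^esub> y) = l2_norm (x - y)"
    if "x \<in> square_summable" "y \<in> square_summable" for x y
    using that by (simp add: minus_l2_space cnorm_l2_space diff_square_summable l2_part_def)
  show ?thesis
    unfolding mcomplete_def
  proof (intro allI impI)
    fix X assume "MCauchy X"
    then have X: "\<And>n. X n \<in> square_summable"
      and Cauchy: "\<And>e. 0 < e \<Longrightarrow> \<exists>N. \<forall>m\<ge>N. \<forall>k\<ge>N. l2_norm (X m - X k) < e"
      unfolding MCauchy_def by (auto simp: d image_subset_iff)
    obtain L where L: "L \<in> square_summable"
      and lim: "\<And>e. 0 < e \<Longrightarrow> \<exists>N. \<forall>m\<ge>N. l2_norm (X m - L) < e"
      using square_summable_Cauchy_limit[OF X Cauchy] by blast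
    have "limitin mtopology X L sequentially"
      using L X lim unfolding limitin_metric eventually_sequentially by (simp add: d)
    then show "\<exists>L. limitin mtopology X L sequentially"
      by blast
  qed
qed

theorem l2_space_hilbert: "complex_hilbert_space l2_space"
proof (intro complex_hilbert_space.intro complex_inner_product_space.intro
    complex_inner_product_space_axioms.intro complex_hilbert_space_axioms.intro)
  show "Module.module complex_field l2_space"
    by (rule l2_space_module)
  show "Metric_space.mcomplete (carrier l2_space) (\<lambda>x y. cnorm l2_space (x \<ominus>\<^bsub>l2_space\<^esub> y))"
    using l2_space_complete by simp
next
  fix x y z :: "nat \<Rightarrow> complex" and a :: complex
  assume x: "x \<in> carrier l2_space"
  show "0 \<le> Re (cinner l2_space x x)"
    using x cinner_l2_space_self[of x] by (simp del: l2_space_simps(5))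
  show "x = \<zero>\<^bsub>l2_space\<^esub>" if "cinner l2_space x x = 0"
    using x that cinner_l2_space_self[of x] by (simp add: l2_norm_eq_0_iff del: l2_space_simps(5))
  assume y: "y \<in> carrier l2_space"
  show "cinner l2_space (a \<odot>\<^bsub>l2_space\<^esub> x) y = a * cinner l2_space x y"
    using suminf_mult[OF summable_mult_cnj[of x y], of a] x y by (simp add: mult.assoc)
  have "cnj (\<Sum>n. y n * cnj (x n)) = (\<Sum>n. cnj (y n * cnj (x n)))"
    using x y by (intro sums_unique sums_cnj[THEN iffD2] summable_sums summable_mult_cnj) simp_all
  then show "cinner l2_space x y = cnj (cinner l2_space y x)"
    by (simp add: mult.commute)
  assume z: "z \<in> carrier l2_space"
  show "cinner l2_space (x \<oplus>\<^bsub>l2_space\<^esub> y) z = cinner l2_space x z + cinner l2_space y z"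
    using suminf_add[OF summable_mult_cnj[of x z] summable_mult_cnj[of y z]] x y z
    by (simp add: algebra_simps)
qed


section \<open>Extending operators from the finitely supported sequences\<close>

definition finite_sequences :: "(nat \<Rightarrow> complex) set" where
  "finite_sequences = {x. finite {n. x n \<noteq> 0}}"

definition unit_sequence :: "nat \<Rightarrow> nat \<Rightarrow> complex" where
  "unit_sequence n = (\<lambda>m. if m = n then 1 else 0)"

abbreviation sequence_scale :: "complex \<Rightarrow> (nat \<Rightarrow> complex) \<Rightarrow> nat \<Rightarrow> complex" where
  "sequence_scale \<equiv> \<lambda>a x n. a * x n"

interpretation sequence_space: vector_space sequence_scale
  by standard (auto simp: fun_eq_iff algebra_simps)

interpretation sequence_space_pair: vector_space_pair sequence_scale sequence_scale ..

lemma linear_sequenceI: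
  assumes "\<And>x y. S (x + y) = S x + S y" and "\<And>a x. S (\<lambda>n. a * x n) = (\<lambda>n. a * S x n)"
  shows "Vector_Spaces.linear sequence_scale sequence_scale S"
  using assms by unfold_locales

lemma finite_sequences_square_summable: "finite_sequences \<subseteq> square_summable"
proof
  fix x assume "x \<in> finite_sequences"
  then show "x \<in> square_summable"
    unfolding square_summable_def finite_sequences_def
    by (auto intro!: summable_finite[of "{n. x n \<noteq> 0}"])
qed

lemma finite_sequences_subspace: "sequence_space.subspace finite_sequences"
proof (rule sequence_space.subspaceI)
  fix x y :: "nat \<Rightarrow> complex" and a :: complex
  assume x: "x \<in> finite_sequences"
  then show "(\<lambda>n. a * x n) \<in> finite_sequences"
    unfolding finite_sequences_def by (auto elim: rev_finite_subset)
  assume "y \<in> finite_sequences"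
  with x have "finite ({n. x n \<noteq> 0} \<union> {n. y n \<noteq> 0})"
    by (simp add: finite_sequences_def)
  then show "x + y \<in> finite_sequences"
    unfolding finite_sequences_def mem_Collect_eq by (rule rev_finite_subset) auto
qed (simp add: finite_sequences_def)

lemma unit_sequence_finite: "unit_sequence n \<in> finite_sequences"
  by (simp add: finite_sequences_def unit_sequence_def)

lemma l2_norm_scaled_unit_sequence: "l2_norm (\<lambda>m. a * unit_sequence n m) = cmod a"
proof -
  have "(\<Sum>m. (cmod (a * unit_sequence n m))\<^sup>2) = (\<Sum>m\<in>{n}. (cmod (a * unit_sequence n m))\<^sup>2)"
    by (rule suminf_finite) (auto simp: unit_sequence_def)
  then show ?thesis
    by (simp add: l2_norm_def unit_sequence_def)
qed

text \<open>
  A linear left inverse, on the space of all sequences, of the inclusion of the finitely supported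
  ones; its existence rests on extending a basis, so it comes without any continuity.
\<close>
lemma finite_sequences_projection:
  obtains P where "Vector_Spaces.linear sequence_scale sequence_scale P"
    and "\<And>x. P x \<in> finite_sequences" and "\<And>x. x \<in> finite_sequences \<Longrightarrow> P x = x"
  using sequence_space_pair.linear_exists_left_inverse_on
    [OF sequence_space.linear_id finite_sequences_subspace] by auto

text \<open>
  With respect to the decomposition of the square summable sequences into the finitely supported
  ones and the kernel of a projection \<open>P\<close> onto them, the witness \<open>T x = x - P x + S (P x)\<close> is the
  direct sum of \<open>S\<close> and the identity.
\<close>
lemma finite_sequence_map_extends:
  assumes S: "Vector_Spaces.linear sequence_scale sequence_scale S"
    and S_finite: "S ` finite_sequences \<subseteq> finite_sequences"
    and unbounded: "\<And>C. \<exists>x\<in>finite_sequences. C * l2_norm x < l2_norm (S x)"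
  obtains T where "linear_operator l2_space square_summable T"
    and "\<not> bounded_operator l2_space square_summable T"
    and "inj_on T square_summable \<longleftrightarrow> inj_on S finite_sequences"
    and "T ` square_summable = square_summable \<longleftrightarrow> S ` finite_sequences = finite_sequences"
proof -
  obtain P where P: "Vector_Spaces.linear sequence_scale sequence_scale P"
    and P_finite: "\<And>x. P x \<in> finite_sequences"
    and P_id: "\<And>x. x \<in> finite_sequences \<Longrightarrow> P x = x"
    by (rule finite_sequences_projection) blast
  interpret S: Vector_Spaces.linear sequence_scale sequence_scale S by (rule S)
  interpret P: Vector_Spaces.linear sequence_scale sequence_scale P by (rule P)
  have fin_l2: "x \<in> square_summable" if "x \<in> finite_sequences" for x
    using that finite_sequences_square_summable by blast
  have SP_finite: "S (P x) \<in> finite_sequences" for x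
    using S_finite P_finite by blast
  define T where "T = (\<lambda>x. x - P x + S (P x))"
  have T_l2: "T x \<in> square_summable" if "x \<in> square_summable" for x
    unfolding T_def
    by (intro add_square_summable diff_square_summable that fin_l2 P_finite SP_finite)
  have T_finite: "T x = S x" if "x \<in> finite_sequences" for x
    using that by (simp add: T_def P_id)
  have PT: "P (T x) = S (P x)" for x
    by (simp add: T_def P.add P.diff P_id P_finite SP_finite)
  show thesis
  proof
    interpret M: Module.module complex_field l2_space
      by (rule l2_space_module)
    have "submodule (carrier l2_space) complex_field l2_space"
      by (rule M.submoduleI)
        (auto simp: zero_square_summable add_square_summable scale_square_summable
          uminus_square_summable a_inv_l2_space l2_part_square_summable)
    moreover have "T (x + y) = T x + T y" for x y
      by (simp add: T_def P.add S.add algebra_simps)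
    moreover have "T (\<lambda>n. a * x n) = (\<lambda>n. a * T x n)" for a x
      by (simp add: T_def P.scale S.scale fun_eq_iff algebra_simps)
    ultimately show "linear_operator l2_space square_summable T"
      unfolding linear_operator_def by (auto simp: T_l2)
    show "\<not> bounded_operator l2_space square_summable T"
    proof
      assume "bounded_operator l2_space square_summable T"
      then obtain C where C: "\<And>x. x \<in> square_summable \<Longrightarrow> l2_norm (T x) \<le> C * l2_norm x"
        unfolding bounded_operator_def by (auto simp: cnorm_l2_space T_l2)
      obtain x where "x \<in> finite_sequences" "C * l2_norm x < l2_norm (S x)"
        using unbounded by blast
      then show False
        using C[of x] by (simp add: fin_l2 T_finite)
    qed
    show "inj_on T square_summable \<longleftrightarrow> inj_on S finite_sequences"
    proof
      assume "inj_on T square_summable"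
      then show "inj_on S finite_sequences"
        unfolding inj_on_def by (metis fin_l2 T_finite)
    next
      assume inj: "inj_on S finite_sequences"
      show "inj_on T square_summable"
      proof (rule inj_onI)
        fix x y assume T: "T x = T y"
        then have "S (P x) = S (P y)"
          by (metis PT)
        moreover from this have "P x = P y"
          using inj P_finite by (simp add: inj_on_def)
        ultimately show "x = y"
          using T by (simp add: T_def)
      qed
    qed
    show "T ` square_summable = square_summable \<longleftrightarrow> S ` finite_sequences = finite_sequences"
    proof
      assume surj: "T ` square_summable = square_summable"
      have "w \<in> S ` finite_sequences" if w: "w \<in> finite_sequences" for w
      proof -
        obtain x where "w = T x"
          using surj fin_l2[OF w] by blast
        then have "w = S (P x)"
          using P_id[OF w] PT by metis
        then show ?thesis
          using P_finite by blast
      qed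
      then show "S ` finite_sequences = finite_sequences"
        using S_finite by blast
    next
      assume surj: "S ` finite_sequences = finite_sequences"
      have "y \<in> T ` square_summable" if y: "y \<in> square_summable" for y
      proof -
        obtain w where w: "w \<in> finite_sequences" "P y = S w"
          using surj P_finite by (metis imageE)
        have "P (y - P y + w) = w"
          using w(1) by (simp add: P.add P.diff P_id P_finite)
        then have "T (y - P y + w) = y"
          using w(2) by (simp add: T_def)
        moreover have "y - P y + w \<in> square_summable"
          by (intro add_square_summable diff_square_summable y fin_l2 P_finite w)
        ultimately show ?thesis
          by (metis imageI)
      qed
      then show "T ` square_summable = square_summable"
        using T_l2 by blast
    qed
  qed
qed


section \<open>Weighted shifts\<close>

text \<open>
  The weights grow, so that the shifts are unbounded; at index 0 the weight of the forward shift
  vanishes, whatever the truncated \<open>0 - 1\<close> selects.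
\<close>
definition forward_shift :: "(nat \<Rightarrow> complex) \<Rightarrow> nat \<Rightarrow> complex" where
  "forward_shift x = (\<lambda>n. of_nat n * x (n - 1))"

definition backward_shift :: "(nat \<Rightarrow> complex) \<Rightarrow> nat \<Rightarrow> complex" where
  "backward_shift x = (\<lambda>n. of_nat (Suc n) * x (Suc n))"

lemma forward_shift_linear:
  "Vector_Spaces.linear sequence_scale sequence_scale forward_shift"
  by (rule linear_sequenceI) (simp_all add: forward_shift_def fun_eq_iff algebra_simps)

lemma backward_shift_linear:
  "Vector_Spaces.linear sequence_scale sequence_scale backward_shift"
  by (rule linear_sequenceI) (simp_all add: backward_shift_def fun_eq_iff algebra_simps)

lemma finite_sequencesI_shifted:
  assumes x: "x \<in> finite_sequences" and y: "\<And>n. x n = 0 \<Longrightarrow> y (Suc n) = 0"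
  shows "y \<in> finite_sequences"
proof -
  have "{n. y n \<noteq> 0} \<subseteq> insert 0 (Suc ` {n. x n \<noteq> 0})"
  proof
    fix n assume "n \<in> {n. y n \<noteq> 0}"
    with y show "n \<in> insert 0 (Suc ` {n. x n \<noteq> 0})"
      by (cases n) auto
  qed
  then show ?thesis
    using x unfolding finite_sequences_def by (auto intro: finite_subset)
qed

lemma forward_shift_finite: "forward_shift ` finite_sequences \<subseteq> finite_sequences"
proof clarify
  fix x assume "x \<in> finite_sequences"
  then show "forward_shift x \<in> finite_sequences"
    by (rule finite_sequencesI_shifted) (simp add: forward_shift_def)
qed

text \<open>
  A finitely supported \<open>y\<close> is the image of \<open>0, y\<^sub>0, y\<^sub>1 / 2, y\<^sub>2 / 3, \<dots>\<close>, which is finitely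
  supported as well.
\<close>
lemma backward_shift_image: "backward_shift ` finite_sequences = finite_sequences"
proof (intro equalityI subsetI)
  fix y assume "y \<in> backward_shift ` finite_sequences"
  then obtain x where x: "x \<in> finite_sequences" and y: "y = backward_shift x"
    by blast
  have "{n. y n \<noteq> 0} \<subseteq> (\<lambda>n. n - 1) ` {n. x n \<noteq> 0}"
    by (force simp: y backward_shift_def image_iff)
  then show "y \<in> finite_sequences"
    using x unfolding finite_sequences_def by (auto intro: finite_subset)
next
  fix y assume y: "y \<in> finite_sequences"
  \<comment> \<open>The entry at index 0 is zero because the denominator is.\<close>
  define x where "x = (\<lambda>n. y (n - 1) / of_nat n)"
  have "x \<in> finite_sequences"
    using y by (rule finite_sequencesI_shifted) (simp add: x_def)
  moreover have "backward_shift x = y"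
    by (simp add: backward_shift_def x_def fun_eq_iff del: of_nat_Suc)
  ultimately show "y \<in> backward_shift ` finite_sequences"
    by blast
qed

lemma forward_shift_inj: "inj forward_shift"
proof (rule injI)
  fix x y assume "forward_shift x = forward_shift y"
  then have "forward_shift x (Suc n) = forward_shift y (Suc n)" for n
    by simp
  then show "x = y"
    by (simp add: forward_shift_def fun_eq_iff del: of_nat_Suc)
qed

lemma forward_shift_not_surj: "forward_shift ` finite_sequences \<noteq> finite_sequences"
proof
  assume "forward_shift ` finite_sequences = finite_sequences"
  then obtain x where "unit_sequence 0 = forward_shift x"
    using unit_sequence_finite by blast
  then have "unit_sequence 0 0 = forward_shift x 0"
    by simp
  then show False
    by (simp add: unit_sequence_def forward_shift_def)
qed

lemma backward_shift_not_inj: "\<not> inj_on backward_shift finite_sequences"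
proof
  assume "inj_on backward_shift finite_sequences"
  moreover have "backward_shift (unit_sequence 0) = backward_shift 0"
    by (simp add: backward_shift_def unit_sequence_def fun_eq_iff)
  moreover have "0 \<in> finite_sequences"
    by (simp add: finite_sequences_def)
  ultimately have "unit_sequence 0 = 0"
    using unit_sequence_finite by (simp add: inj_on_def)
  then have "unit_sequence 0 0 = 0"
    by simp
  then show False
    by (simp add: unit_sequence_def)
qed

lemma unbounded_on_finite_sequencesI:
  assumes S: "\<And>n. l2_norm (S (unit_sequence (g n))) = real (Suc n)"
  shows "\<exists>x\<in>finite_sequences. C * l2_norm x < l2_norm (S x)"
proof -
  obtain n where "C < real n"
    using reals_Archimedean2 by blast
  then have "C * l2_norm (unit_sequence (g n)) < l2_norm (S (unit_sequence (g n)))"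
    using l2_norm_scaled_unit_sequence[of 1] S[of n] by simp
  then show ?thesis
    using unit_sequence_finite by blast
qed

lemma forward_shift_unit_sequence:
  "forward_shift (unit_sequence n) = (\<lambda>m. of_nat (Suc n) * unit_sequence (Suc n) m)"
  by (auto simp: forward_shift_def unit_sequence_def fun_eq_iff)

lemma backward_shift_unit_sequence:
  "backward_shift (unit_sequence (Suc n)) = (\<lambda>m. of_nat (Suc n) * unit_sequence n m)"
  by (auto simp: backward_shift_def unit_sequence_def fun_eq_iff)

lemma forward_shift_unbounded:
  "\<exists>x\<in>finite_sequences. C * l2_norm x < l2_norm (forward_shift x)"
  by (rule unbounded_on_finite_sequencesI[where g = "\<lambda>n. n"])
    (simp only: forward_shift_unit_sequence l2_norm_scaled_unit_sequence norm_of_nat)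

lemma backward_shift_unbounded:
  "\<exists>x\<in>finite_sequences. C * l2_norm x < l2_norm (backward_shift x)"
  by (rule unbounded_on_finite_sequencesI[where g = Suc])
    (simp only: backward_shift_unit_sequence l2_norm_scaled_unit_sequence norm_of_nat)

theorem proposition1p34:
  shows "(\<exists>(K :: (nat \<Rightarrow> complex) inner_space) D T.
            complex_hilbert_space K \<and> linear_operator K D T \<and> everywhere_defined K D \<and>
            \<not> bounded_operator K D T \<and>
            inj_on T (carrier K) \<and> \<not> T ` carrier K = carrier K) \<and>
         (\<exists>(K :: (nat \<Rightarrow> complex) inner_space) D T.
            complex_hilbert_space K \<and> linear_operator K D T \<and> everywhere_defined K D \<and>
            \<not> bounded_operator K D T \<and>
            T ` carrier K = carrier K \<and> \<not> inj_on T (carrier K))"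
proof (rule conjI)
  obtain T where "linear_operator l2_space square_summable T"
    and "\<not> bounded_operator l2_space square_summable T"
    and "inj_on T square_summable" and "T ` square_summable \<noteq> square_summable"
    using finite_sequence_map_extends[OF forward_shift_linear forward_shift_finite
        forward_shift_unbounded] forward_shift_not_surj
      inj_on_subset[OF forward_shift_inj subset_UNIV]
    by metis
  then show "\<exists>(K :: (nat \<Rightarrow> complex) inner_space) D T.
            complex_hilbert_space K \<and> linear_operator K D T \<and> everywhere_defined K D \<and>
            \<not> bounded_operator K D T \<and>
            inj_on T (carrier K) \<and> \<not> T ` carrier K = carrier K"
    by (intro exI[of _ l2_space] exI[of _ square_summable] exI[of _ T])
      (simp add: l2_space_hilbert everywhere_defined_def)
next
  obtain T where "linear_operator l2_space square_summable T"
    and "\<not> bounded_operator l2_space square_summable T"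
    and "T ` square_summable = square_summable" and "\<not> inj_on T square_summable"
    using finite_sequence_map_extends[OF backward_shift_linear
        equalityD1[OF backward_shift_image] backward_shift_unbounded]
      backward_shift_image backward_shift_not_inj
    by metis
  then show "\<exists>(K :: (nat \<Rightarrow> complex) inner_space) D T.
            complex_hilbert_space K \<and> linear_operator K D T \<and> everywhere_defined K D \<and>
            \<not> bounded_operator K D T \<and>
            T ` carrier K = carrier K \<and> \<not> inj_on T (carrier K)"
    by (intro exI[of _ l2_space] exI[of _ square_summable] exI[of _ T])
      (simp add: l2_space_hilbert everywhere_defined_def)
qed

end
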